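(* Consider the second-order control system, the set $\mathcal{C}$, the functions $B_i$ and $B$ (depending on parameters $\gamma,\epsilon>0$), and the set $\mathcal{C}^s=\{x\in\mathbb{R}^{2n}: B(x)\ge 0\}$ described in the context. Suppose that (Assumption 1) $\operatorname{Proj}_n(\mathcal{C})$ is compact and, for every $I\in\mathcal{S}_\cap$, a point $y_I\in\mathcal{C}$ is chosen with $h_i(y_I)>0$ for all $i\in I$; let $\delta=\min_{I\in\mathcal{S}_\cap,\, i\in I}h_i(y_I)>0$. Let $\gamma,\epsilon>0$ satisfy $\gamma\delta>\epsilon$, and assume that $G_2(x)$ is right invertible for all $x\in\partial\mathcal{C}^s$. Then there exists a compact set $\mathcal{U}\subsetneq\mathbb{R}^m$ for which the General Safety Condition is satisfied: for each $x\in\partial\mathcal{C}^s$ there exists $u_x\in\mathcal{U}$ such that $$\nabla B_i(x)^\top\big(f(x)+G(x)u_x\big)>0\quad\text{for all } i\in\tilde{\mathcal{I}}(x).$$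
   Context: Dynamics: $\dot x=f(x)+G(x)u$ with $x=(x_1,x_2)$, $x_1,x_2\in\mathbb{R}^n$, $u\in\mathbb{R}^m$, $f(x)=(x_2,f_2(x))$, $G(x)=(\mathbf{0}_{n\times m},G_2(x))$ (stacked blocks), where $f_2:\mathbb{R}^{2n}\to\mathbb{R}^n$ and $G_2:\mathbb{R}^{2n}\to\mathbb{R}^{n\times m}$ are Lipschitz ($n\ge 1$). For a set $S\subseteq\mathbb{R}^{2n}$, $\operatorname{Proj}_n(S)\subseteq\mathbb{R}^n$ is its projection on the first $n$ components, and $\partial S$ is its boundary. Half-spaces: let $\mathcal{I}=\{1,\dots,r\}$. For $i\in\mathcal{I}$, let $a_i\in\mathbb{R}^n$, $b_i\in\mathbb{R}$ with $\|a_i\|\ne 0$ and $b_i\neq 0$, such that for $i\ne i'$ the augmented vectors $(a_i,b_i)$ and $(a_{i'},b_{i'})$ are linearly independent. Set $h_i(x)=a_i^\top x_1+b_i$ and $\mathcal{C}_i=\{x\in\mathbb{R}^{2n} : h_i(x)\ge 0\}$. Desired safe set: $\mathcal{L}\subset\mathbb{N}$ is a nonempty finite index set and $\mathcal{I}^\ell\subseteq\mathcal{I}$ is nonempty for each $\ell\in\mathcal{L}$. Set $\mathcal{C}=\bigcup_{\ell\in\mathcal{L}}\bigcap_{i\in\mathcal{I}^\ell}\mathcal{C}_i$, assumed nonempty. $\mathcal{S}_\cap$ is the collection of all $I\subseteq\mathcal{I}$ such that $\left(\bigcap_{i\in I}\mathcal{C}_i\right)\cap\mathcal{C}\neq\emptyset$.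 Construction of $B$: given parameters $\gamma,\epsilon>0$, for $1\le i\le r$ put $B_i(x)=h_i(x)$ and $B_{i+r}(x)=a_i^\top x_2+\gamma(a_i^\top x_1+b_i)-\epsilon$. Put $\bar{\mathcal{L}}=\mathcal{L}$, $\bar{\mathcal{I}}^\ell=\mathcal{I}^\ell\cup\{i+r : i\in\mathcal{I}^\ell\}$, $B^\ell(x)=\min_{i\in\bar{\mathcal{I}}^\ell}B_i(x)$, and $B(x)=\max_{\ell\in\bar{\mathcal{L}}}B^\ell(x)$. Active indices: $\mathcal{L}_i=\{\ell\in\bar{\mathcal{L}} : i\in\bar{\mathcal{I}}^\ell\}$ and $\tilde{\mathcal{I}}(x)=\{i\in\{1,\dots,2r\} : \exists\,\ell\in\mathcal{L}_i \text{ with } B(x)=B^\ell(x)=B_i(x)\}$. *)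

theory Defs
  imports "HOL-Analysis.Analysis"
begin

text \<open>
  States x = (x1, x2) of the second-order system live in the Euclidean product space
  \<open>(real^'n) \<times> (real^'n)\<close>; inputs live in \<open>real^'m\<close>. Vectors \<open>a\<close>, offsets \<open>b\<close> and index sets
  \<open>Is\<close> are families indexed by natural numbers, used only on \<open>{1..r}\<close> and \<open>L\<close> respectively.
\<close>

type_synonym 'n state = "(real^'n) \<times> (real^'n)"

text \<open>The \<open>2n \<times> m\<close> matrix \<open>G(x)\<close> is encoded as the pair of its upper and lower \<open>n \<times> m\<close> blocks.\<close>

definition stacked_mult ::
  "(real^'m^'n) \<times> (real^'m^'n) \<Rightarrow> real^'m \<Rightarrow> 'n::finite state" where
  "stacked_mult M u = (fst M *v u, snd M *v u)"

definition drift :: "('n state \<Rightarrow> real^'n) \<Rightarrow> 'n::finite state \<Rightarrow> 'n state" where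
  "drift f2 x = (snd x, f2 x)"

definition input_matrix ::
  "('n state \<Rightarrow> real^'m^'n) \<Rightarrow> 'n::finite state \<Rightarrow> (real^'m^'n) \<times> (real^'m^'n)" where
  "input_matrix G2 x = (0, G2 x)"

definition right_invertible :: "real^'m^'n \<Rightarrow> bool" where
  "right_invertible A \<longleftrightarrow> (\<exists>R. A ** R = mat 1)"

definition grad :: "('a::real_inner \<Rightarrow> real) \<Rightarrow> 'a \<Rightarrow> 'a" where
  "grad F x = (THE D. GDERIV F x :> D)"

definition hfun :: "(nat \<Rightarrow> real^'n) \<Rightarrow> (nat \<Rightarrow> real) \<Rightarrow> nat \<Rightarrow> 'n::finite state \<Rightarrow> real" where
  "hfun a b i x = a i \<bullet> fst x + b i"

definition half_space :: "(nat \<Rightarrow> real^'n) \<Rightarrow> (nat \<Rightarrow> real) \<Rightarrow> nat \<Rightarrow> 'n::finite state set" where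
  "half_space a b i = {x. hfun a b i x \<ge> 0}"

definition desired_set ::
  "(nat \<Rightarrow> real^'n) \<Rightarrow> (nat \<Rightarrow> real) \<Rightarrow> nat set \<Rightarrow> (nat \<Rightarrow> nat set) \<Rightarrow> 'n::finite state set" where
  "desired_set a b L Is = (\<Union>l\<in>L. \<Inter>i\<in>Is l. half_space a b i)"

text \<open>The empty index set is included (its intersection is the whole space).\<close>

definition S_cap ::
  "(nat \<Rightarrow> real^'n::finite) \<Rightarrow> (nat \<Rightarrow> real) \<Rightarrow> nat \<Rightarrow> nat set \<Rightarrow> (nat \<Rightarrow> nat set) \<Rightarrow> nat set set" where
  "S_cap a b r L Is =
     {I. I \<subseteq> {1..r} \<and> (\<Inter>i\<in>I. half_space a b i) \<inter> desired_set a b L Is \<noteq> {}}"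

text \<open>Meaningful for \<open>i \<in> {1..2*r}\<close>.\<close>

definition Bcomp ::
  "(nat \<Rightarrow> real^'n) \<Rightarrow> (nat \<Rightarrow> real) \<Rightarrow> nat \<Rightarrow> real \<Rightarrow> real \<Rightarrow> nat \<Rightarrow> 'n::finite state \<Rightarrow> real" where
  "Bcomp a b r \<gamma> \<epsilon> i x =
     (if i \<le> r then hfun a b i x
      else a (i - r) \<bullet> snd x + \<gamma> * (a (i - r) \<bullet> fst x + b (i - r)) - \<epsilon>)"

definition Ibar :: "nat \<Rightarrow> (nat \<Rightarrow> nat set) \<Rightarrow> nat \<Rightarrow> nat set" where
  "Ibar r Is l = Is l \<union> {i + r | i. i \<in> Is l}"

definition Bmin ::
  "(nat \<Rightarrow> real^'n) \<Rightarrow> (nat \<Rightarrow> real) \<Rightarrow> nat \<Rightarrow> (nat \<Rightarrow> nat set) \<Rightarrow> real \<Rightarrow> real \<Rightarrow>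
     nat \<Rightarrow> 'n::finite state \<Rightarrow> real" where
  "Bmin a b r Is \<gamma> \<epsilon> l x = Min ((\<lambda>i. Bcomp a b r \<gamma> \<epsilon> i x) ` Ibar r Is l)"

definition Bfun ::
  "(nat \<Rightarrow> real^'n) \<Rightarrow> (nat \<Rightarrow> real) \<Rightarrow> nat \<Rightarrow> nat set \<Rightarrow> (nat \<Rightarrow> nat set) \<Rightarrow> real \<Rightarrow> real \<Rightarrow>
     'n::finite state \<Rightarrow> real" where
  "Bfun a b r L Is \<gamma> \<epsilon> x = Max ((\<lambda>l. Bmin a b r Is \<gamma> \<epsilon> l x) ` L)"

definition safe_set ::
  "(nat \<Rightarrow> real^'n) \<Rightarrow> (nat \<Rightarrow> real) \<Rightarrow> nat \<Rightarrow> nat set \<Rightarrow> (nat \<Rightarrow> nat set) \<Rightarrow> real \<Rightarrow> real \<Rightarrow>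
     'n::finite state set" where
  "safe_set a b r L Is \<gamma> \<epsilon> = {x. Bfun a b r L Is \<gamma> \<epsilon> x \<ge> 0}"

definition Lidx :: "nat \<Rightarrow> nat set \<Rightarrow> (nat \<Rightarrow> nat set) \<Rightarrow> nat \<Rightarrow> nat set" where
  "Lidx r L Is i = {l \<in> L. i \<in> Ibar r Is l}"

definition active ::
  "(nat \<Rightarrow> real^'n) \<Rightarrow> (nat \<Rightarrow> real) \<Rightarrow> nat \<Rightarrow> nat set \<Rightarrow> (nat \<Rightarrow> nat set) \<Rightarrow> real \<Rightarrow> real \<Rightarrow>
     'n::finite state \<Rightarrow> nat set" where
  "active a b r L Is \<gamma> \<epsilon> x =
     {i \<in> {1..2*r}. \<exists>l \<in> Lidx r L Is i.
        Bfun a b r L Is \<gamma> \<epsilon> x = Bmin a b r Is \<gamma> \<epsilon> l x \<and>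
        Bmin a b r Is \<gamma> \<epsilon> l x = Bcomp a b r \<gamma> \<epsilon> i x}"

definition general_safety_condition ::
  "('n::finite state \<Rightarrow> real^'n) \<Rightarrow> ('n state \<Rightarrow> real^'m^'n) \<Rightarrow>
     (nat \<Rightarrow> real^'n) \<Rightarrow> (nat \<Rightarrow> real) \<Rightarrow> nat \<Rightarrow> nat set \<Rightarrow> (nat \<Rightarrow> nat set) \<Rightarrow> real \<Rightarrow> real \<Rightarrow>
     (real^'m) set \<Rightarrow> bool" where
  "general_safety_condition f2 G2 a b r L Is \<gamma> \<epsilon> U \<longleftrightarrow>
     (\<forall>x \<in> frontier (safe_set a b r L Is \<gamma> \<epsilon>). \<exists>u \<in> U.
        \<forall>i \<in> active a b r L Is \<gamma> \<epsilon> x.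
          grad (Bcomp a b r \<gamma> \<epsilon> i) x \<bullet> (drift f2 x + stacked_mult (input_matrix G2 x) u) > 0)"

end

theory Submission
  imports Defs
begin

text \<open>
  On the boundary \<open>B = 0\<close>. An active position constraint \<open>h\<^sub>i = 0\<close> has derivative
  \<open>a\<^sub>i \<bullet> x\<^sub>2 \<ge> \<epsilon>\<close>, because the velocity constraint of the same branch is nonnegative, whatever the
  input is. The indices \<open>i\<close> with \<open>h\<^sub>i(x) \<ge> 0\<close> form a set \<open>J \<in> S\<^sub>\<inter>\<close> that contains those of the
  active velocity constraints, and an input that produces the acceleration
  \<open>\<gamma> (y\<^sub>J - x\<^sub>1) - (1 + \<gamma>) x\<^sub>2\<close> (with \<open>y\<^sub>J\<close> projected to positions) gives each of them the derivative
  \<open>\<gamma> h\<^sub>i(y\<^sub>J) - \<epsilon> \<ge> \<gamma> \<delta> - \<epsilon> > 0\<close>. For a fixed input the set of states at which it is admissible is open,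
  and the safe set is compact, since \<open>x\<^sub>1\<close> and \<open>x\<^sub>1 + x\<^sub>2 / \<gamma>\<close> both lie in the compact projection of \<open>C\<close>.
  Hence finitely many inputs suffice.
\<close>

section \<open>Gradients of the constraint functions\<close>

lemma grad_eqI:
  assumes "GDERIV F x :> D"
  shows "grad F x = D"
  unfolding grad_def
proof (rule the_equality)
  fix D'
  assume "GDERIV F x :> D'"
  then have "(\<lambda>h. h \<bullet> D') = (\<lambda>h. h \<bullet> D)"
    using assms unfolding gderiv_def by (rule has_derivative_unique)
  then show "D' = D"
    by (metis inner_eq_zero_iff inner_diff_right right_minus_eq)
qed (fact assms)

lemma GDERIV_affine: "GDERIV (\<lambda>x. D \<bullet> x + c) x :> D"
  unfolding gderiv_def by (auto intro!: derivative_eq_intros simp: inner_commute)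

text \<open>Each \<open>Bcomp\<close> is affine in the state, so its gradient does not vary with
  \<open>x\<close>; the openness argument for \<open>admissible\<close> relies on this.\<close>

lemma grad_Bcomp:
  "grad (Bcomp a b r \<gamma> \<epsilon> i) x =
     (if i \<le> r then (a i, 0) else (\<gamma> *\<^sub>R a (i - r), a (i - r)))"
proof -
  have "Bcomp a b r \<gamma> \<epsilon> i = (\<lambda>x. (a i, 0) \<bullet> x + b i)" if "i \<le> r"
    using that by (auto simp: fun_eq_iff Bcomp_def hfun_def inner_prod_def)
  moreover have "Bcomp a b r \<gamma> \<epsilon> i =
      (\<lambda>x. (\<gamma> *\<^sub>R a (i - r), a (i - r)) \<bullet> x + (\<gamma> * b (i - r) - \<epsilon>))" if "\<not> i \<le> r"
    using that by (auto simp: fun_eq_iff Bcomp_def inner_prod_def algebra_simps)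
  ultimately show ?thesis
    by (simp add: grad_eqI GDERIV_affine)
qed

section \<open>Continuity of \<open>Bfun\<close> and closedness of activity\<close>

lemma continuous_on_Min_image:
  fixes f :: "'i \<Rightarrow> 'a::topological_space \<Rightarrow> real"
  assumes "finite I" "I \<noteq> {}" "\<And>i. i \<in> I \<Longrightarrow> continuous_on S (f i)"
  shows "continuous_on S (\<lambda>x. Min ((\<lambda>i. f i x) ` I))"
  using assms
proof (induction I rule: finite_ne_induct)
  case (insert i I)
  then have "continuous_on S (\<lambda>x. min (f i x) (Min ((\<lambda>i. f i x) ` I)))"
    by (intro continuous_on_min) auto
  with insert.hyps show ?case by simp
qed simp

lemma continuous_on_Max_image:
  fixes f :: "'i \<Rightarrow> 'a::topological_space \<Rightarrow> real"
  assumes "finite I" "I \<noteq> {}" "\<And>i. i \<in> I \<Longrightarrow> continuous_on S (f i)"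
  shows "continuous_on S (\<lambda>x. Max ((\<lambda>i. f i x) ` I))"
  using assms
proof (induction I rule: finite_ne_induct)
  case (insert i I)
  then have "continuous_on S (\<lambda>x. max (f i x) (Max ((\<lambda>i. f i x) ` I)))"
    by (intro continuous_on_max) auto
  with insert.hyps show ?case by simp
qed simp

lemma finite_Ibar: "finite (Is l) \<Longrightarrow> finite (Ibar r Is l)"
  by (simp add: Ibar_def)

lemma continuous_on_Bcomp: "continuous_on S (Bcomp a b r \<gamma> \<epsilon> i)"
  unfolding Bcomp_def hfun_def by (cases "i \<le> r") (auto intro!: continuous_intros)

lemma continuous_on_Bmin:
  assumes "finite (Is l)" "Is l \<noteq> {}"
  shows "continuous_on S (Bmin a b r Is \<gamma> \<epsilon> l)"
  unfolding Bmin_def using assms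
  by (intro continuous_on_Min_image finite_Ibar continuous_on_Bcomp) (auto simp: Ibar_def)

lemma continuous_on_Bfun:
  assumes "finite L" "L \<noteq> {}" "\<forall>l\<in>L. finite (Is l) \<and> Is l \<noteq> {}"
  shows "continuous_on S (Bfun a b r L Is \<gamma> \<epsilon>)"
  unfolding Bfun_def using assms
  by (intro continuous_on_Max_image continuous_on_Bmin) auto

text \<open>Activity is a finite union of equalities between continuous functions. Hence an inactive
  index stays inactive nearby: the active set can only shrink under small perturbations.\<close>

lemma closed_active:
  assumes "finite L" "L \<noteq> {}" "\<forall>l\<in>L. finite (Is l) \<and> Is l \<noteq> {}"
  shows "closed {x. i \<in> active a b r L Is \<gamma> \<epsilon> x}"
proof (cases "i \<in> {1..2*r}")
  case True
  then have "{x. i \<in> active a b r L Is \<gamma> \<epsilon> x} = (\<Union>l\<in>Lidx r L Is i.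
      {x. Bfun a b r L Is \<gamma> \<epsilon> x = Bmin a b r Is \<gamma> \<epsilon> l x} \<inter>
      {x. Bmin a b r Is \<gamma> \<epsilon> l x = Bcomp a b r \<gamma> \<epsilon> i x})"
    by (auto simp: active_def)
  moreover have "closed \<dots>"
    using assms
    by (intro closed_UN ballI closed_Int closed_Collect_eq continuous_on_Bfun continuous_on_Bmin
        continuous_on_Bcomp) (auto simp: Lidx_def)
  ultimately show ?thesis by simp
next
  case False
  then have "{x. i \<in> active a b r L Is \<gamma> \<epsilon> x} = {}"
    by (auto simp: active_def)
  then show ?thesis by (simp only: closed_empty)
qed

section \<open>The safe set and its boundary\<close>

lemma Bfun_attained:
  assumes "finite L" "L \<noteq> {}"
  obtains l where "l \<in> L" "Bfun a b r L Is \<gamma> \<epsilon> x = Bmin a b r Is \<gamma> \<epsilon> l x"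
proof -
  have "Bfun a b r L Is \<gamma> \<epsilon> x \<in> (\<lambda>l. Bmin a b r Is \<gamma> \<epsilon> l x) ` L"
    unfolding Bfun_def using assms by (intro Max_in) auto
  then show ?thesis using that by blast
qed

lemma Bmin_nonneg_constraints:
  assumes "Is l \<subseteq> {1..r}" "Bmin a b r Is \<gamma> \<epsilon> l x \<ge> 0" "i \<in> Is l"
  shows "hfun a b i x \<ge> 0" "a i \<bullet> snd x + \<gamma> * hfun a b i x \<ge> \<epsilon>"
proof -
  have fin: "finite (Is l)"
    using assms(1) finite_subset by blast
  have *: "Bcomp a b r \<gamma> \<epsilon> j x \<ge> 0" if "j \<in> Ibar r Is l" for j
    using assms(2) that finite_Ibar[of Is l r, OF fin] unfolding Bmin_def
    by (meson Min_le finite_imageI imageI order_trans)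
  \<comment> \<open>The bound \<open>i \<ge> 1\<close> gives \<open>i + r > r\<close>, so
    \<open>Bcomp\<close> at \<open>i + r\<close> takes its velocity branch.\<close>
  have "i \<le> r" "i \<ge> 1" using assms by auto
  then show "hfun a b i x \<ge> 0" "a i \<bullet> snd x + \<gamma> * hfun a b i x \<ge> \<epsilon>"
    using *[of i] *[of "i + r"] assms(3) by (auto simp: Ibar_def Bcomp_def hfun_def)
qed

lemma compact_safe_set:
  assumes L: "finite L" "L \<noteq> {}"
    and Is: "\<forall>l\<in>L. Is l \<subseteq> {1..r}" "\<forall>l\<in>L. Is l \<noteq> {}"
    and proj: "bounded (fst ` desired_set a b L Is)"
    and pos: "\<gamma> > 0" "\<epsilon> > 0"
  shows "compact (safe_set a b r L Is \<gamma> \<epsilon>)"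
proof -
  have fin: "\<forall>l\<in>L. finite (Is l) \<and> Is l \<noteq> {}"
    using Is finite_subset by blast
  have "closed (safe_set a b r L Is \<gamma> \<epsilon>)"
    unfolding safe_set_def
    by (intro closed_Collect_le continuous_on_const continuous_on_Bfun L fin)
  moreover have "bounded (safe_set a b r L Is \<gamma> \<epsilon>)"
  proof -
    obtain M where M: "\<And>p. p \<in> fst ` desired_set a b L Is \<Longrightarrow> norm p \<le> M"
      using proj unfolding bounded_iff by blast
    have "norm x \<le> M + \<gamma> * (2 * M)" if x: "x \<in> safe_set a b r L Is \<gamma> \<epsilon>" for x
    proof -
      obtain l where l: "l \<in> L" "Bmin a b r Is \<gamma> \<epsilon> l x \<ge> 0"
        using x Bfun_attained[OF L] unfolding safe_set_def by (metis mem_Collect_eq)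
      note con = Bmin_nonneg_constraints[of Is l r a b \<gamma> \<epsilon> x, OF _ l(2)]
      \<comment> \<open>Divided by \<open>\<gamma>\<close>, the velocity constraint bounds
        \<open>hfun\<close> at position \<open>z\<close> below by
        \<open>\<epsilon> / \<gamma>\<close>, so \<open>z\<close> is again a position in the desired
        set. The velocity 0 in \<open>(z, 0)\<close> is a filler, as \<open>hfun\<close> reads
        positions only.\<close>
      define z where "z = fst x + (1 / \<gamma>) *\<^sub>R snd x"
      have "x \<in> desired_set a b L Is"
        using l Is con by (fastforce simp: desired_set_def half_space_def)
      then have x1: "norm (fst x) \<le> M" using M by blast
      have "hfun a b i (z, 0) \<ge> 0" if "i \<in> Is l" for i
      proof -
        have "\<gamma> * hfun a b i (z, 0) = a i \<bullet> snd x + \<gamma> * hfun a b i x"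
          using pos by (simp add: z_def hfun_def algebra_simps inner_simps)
        also have "\<dots> \<ge> 0" using con(2)[of i] Is l(1) that pos by force
        finally show ?thesis using pos by (simp add: zero_le_mult_iff)
      qed
      then have "(z, 0) \<in> desired_set a b L Is"
        using l(1) by (auto simp: desired_set_def half_space_def)
      then have "norm z \<le> M" using M by force
      moreover have "snd x = \<gamma> *\<^sub>R (z - fst x)"
        using pos by (simp add: z_def)
      ultimately have "norm (snd x) \<le> \<gamma> * (2 * M)"
        using x1 norm_triangle_ineq4[of z "fst x"] pos by (auto intro!: mult_left_mono)
      then show ?thesis
        using x1 norm_Pair_le[of "fst x" "snd x"] by simp
    qed
    then show ?thesis unfolding bounded_iff by blast
  qed
  ultimately show ?thesis by (simp add: compact_eq_bounded_closed)
qed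

text \<open>By continuity the safe set is closed, and the open set where \<open>Bfun\<close> is
  positive lies in its interior, which the frontier avoids.\<close>

lemma Bfun_frontier_safe_set:
  assumes "finite L" "L \<noteq> {}" "\<forall>l\<in>L. finite (Is l) \<and> Is l \<noteq> {}"
    and x: "x \<in> frontier (safe_set a b r L Is \<gamma> \<epsilon>)"
  shows "Bfun a b r L Is \<gamma> \<epsilon> x = 0"
proof -
  note cont = continuous_on_Bfun[OF assms(1-3)]
  have "closed (safe_set a b r L Is \<gamma> \<epsilon>)"
    unfolding safe_set_def by (intro closed_Collect_le continuous_on_const cont)
  then have "Bfun a b r L Is \<gamma> \<epsilon> x \<ge> 0"
    using x frontier_subset_closed unfolding safe_set_def by blast
  moreover have "{x. 0 < Bfun a b r L Is \<gamma> \<epsilon> x} \<subseteq> interior (safe_set a b r L Is \<gamma> \<epsilon>)"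
    by (intro interior_maximal open_Collect_less continuous_on_const cont)
       (auto simp: safe_set_def)
  ultimately show ?thesis
    using x by (force simp: frontier_def)
qed

text \<open>A branch that makes \<open>i\<close> active has minimum 0, so all its constraints are
  nonnegative. Each active constraint thus comes with its partner: the velocity constraint where
  \<open>hfun\<close> vanishes, or the position constraint of the same \<open>j\<close>.\<close>

lemma active_cases:
  assumes "Is ` L \<subseteq> Pow {1..r}" "Bfun a b r L Is \<gamma> \<epsilon> x = 0"
    and "i \<in> active a b r L Is \<gamma> \<epsilon> x"
  obtains (position) "i \<in> {1..r}" "hfun a b i x = 0" "a i \<bullet> snd x \<ge> \<epsilon>"
    | (velocity) j where "i = j + r" "j \<in> {1..r}" "hfun a b j x \<ge> 0"
        "a j \<bullet> snd x + \<gamma> * hfun a b j x = \<epsilon>"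
proof -
  obtain l where l: "l \<in> L" "i \<in> Ibar r Is l" "Bmin a b r Is \<gamma> \<epsilon> l x = 0"
      "Bcomp a b r \<gamma> \<epsilon> i x = 0"
    using assms(2,3) by (auto simp: active_def Lidx_def)
  have sub: "Is l \<subseteq> {1..r}" using assms(1) l(1) by blast
  note con = Bmin_nonneg_constraints[of Is l r a b \<gamma> \<epsilon> x, OF sub]
  consider "i \<in> Is l" | j where "j \<in> Is l" "i = j + r"
    using l(2) by (auto simp: Ibar_def)
  then show ?thesis
  proof cases
    case 1
    then have "i \<in> {1..r}" using sub by blast
    moreover from this l(4) have "hfun a b i x = 0" by (simp add: Bcomp_def)
    ultimately show ?thesis using con(2)[of i] 1 l(3) position by simp
  next
    case 2
    then have "j \<in> {1..r}" using sub by blast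
    moreover from this l(4) 2 have "a j \<bullet> snd x + \<gamma> * hfun a b j x = \<epsilon>"
      by (auto simp: Bcomp_def hfun_def)
    ultimately show ?thesis using con(1)[of j] 2 l(3) velocity by simp
  qed
qed

section \<open>Admissible inputs\<close>

lemma right_invertible_surj:
  assumes "right_invertible A"
  obtains u where "A *v u = v"
  using assms unfolding right_invertible_def
  by (metis matrix_vector_mul_assoc matrix_vector_mul_lid)

text \<open>Isolates the safety condition at one state and one input, so that the set of states can
  be studied for a fixed input.\<close>

definition admissible where
  "admissible f2 G2 a b r L Is \<gamma> \<epsilon> u x \<longleftrightarrow>
     (\<forall>i \<in> active a b r L Is \<gamma> \<epsilon> x.
        grad (Bcomp a b r \<gamma> \<epsilon> i) x \<bullet> (drift f2 x + stacked_mult (input_matrix G2 x) u) > 0)"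

lemma open_admissible:
  fixes G2 :: "'n::finite state \<Rightarrow> real^'m^'n"
  assumes "continuous_on UNIV f2" "continuous_on UNIV G2"
    and "finite L" "L \<noteq> {}" "\<forall>l\<in>L. finite (Is l) \<and> Is l \<noteq> {}"
  shows "open {x. admissible f2 G2 a b r L Is \<gamma> \<epsilon> u x}"
proof -
  let ?F = "\<lambda>x. drift f2 x + stacked_mult (input_matrix G2 x) u"
  have "linear (\<lambda>A :: real^'m^'n. A *v u)"
    by (auto intro!: linearI simp: matrix_vector_mult_add_rdistrib scaleR_matrix_vector_assoc)
  then have "continuous_on UNIV (\<lambda>x. G2 x *v u)"
    by (rule linear_continuous_on_compose[OF assms(2)])
  then have F: "continuous_on UNIV ?F"
    unfolding drift_def stacked_mult_def input_matrix_def
    by (auto intro!: continuous_intros assms(1))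
  have "open {x. 0 < grad (Bcomp a b r \<gamma> \<epsilon> i) x \<bullet> ?F x}" for i
    unfolding grad_Bcomp by (intro open_Collect_less continuous_intros F)
  \<comment> \<open>The index range of \<open>admissible\<close> varies with \<open>x\<close>; over
    the fixed finite range it becomes an intersection of open conditions: inactive, or strictly
    positive.\<close>
  moreover have "{x. admissible f2 G2 a b r L Is \<gamma> \<epsilon> u x} = (\<Inter>i\<in>{1..2*r}.
      - {x. i \<in> active a b r L Is \<gamma> \<epsilon> x} \<union> {x. 0 < grad (Bcomp a b r \<gamma> \<epsilon> i) x \<bullet> ?F x})"
    by (auto simp: admissible_def active_def)
  ultimately show ?thesis
    by (auto intro!: open_INT open_Un open_Compl closed_active assms(3-5))
qed

lemma admissible_input_exists:
  fixes G2 :: "'n::finite state \<Rightarrow> real^'m^'n"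
  assumes L: "finite L" "L \<noteq> {}"
    and Is: "\<forall>l\<in>L. Is l \<subseteq> {1..r}"
    and B0: "Bfun a b r L Is \<gamma> \<epsilon> x = 0"
    and y: "\<And>I i. I \<in> S_cap a b r L Is \<Longrightarrow> i \<in> I \<Longrightarrow> \<gamma> * hfun a b i (y I) > \<epsilon>"
    and pos: "\<epsilon> > 0"
    and inv: "right_invertible (G2 x)"
  shows "\<exists>u. admissible f2 G2 a b r L Is \<gamma> \<epsilon> u x"
proof -
  have Is': "Is ` L \<subseteq> Pow {1..r}" using Is by blast
  \<comment> \<open>Collecting indices over all branches lets one point \<open>y J\<close> serve
    every active velocity constraint at once.\<close>
  define J where "J = {j \<in> {1..r}. hfun a b j x \<ge> 0}"
  have "x \<in> desired_set a b L Is"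
  proof -
    obtain l where "l \<in> L" "Bmin a b r Is \<gamma> \<epsilon> l x = 0"
      using Bfun_attained[OF L] B0 by metis
    then show ?thesis
      using Bmin_nonneg_constraints(1)[of Is l r a b \<gamma> \<epsilon> x] Is
      by (fastforce simp: desired_set_def half_space_def)
  qed
  then have J: "J \<in> S_cap a b r L Is"
    by (auto simp: S_cap_def J_def half_space_def)
  \<comment> \<open>The term \<open>- f2 x\<close> cancels the drift. The derivative of a velocity
    constraint \<open>j\<close> becomes \<open>\<gamma> * (hfun a b j (y J) - hfun a b j x) - a j
    \<bullet> snd x\<close>, and activity turns the last two terms into
    \<open>- \<epsilon>\<close>.\<close>
  obtain u where u: "G2 x *v u =
      - f2 x + \<gamma> *\<^sub>R (fst (y J) - fst x) - (1 + \<gamma>) *\<^sub>R snd x"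
    using right_invertible_surj[OF inv] by metis
  have "grad (Bcomp a b r \<gamma> \<epsilon> i) x \<bullet> (drift f2 x + stacked_mult (input_matrix G2 x) u) > 0"
    if "i \<in> active a b r L Is \<gamma> \<epsilon> x" for i
    using Is' B0 that
  proof (cases rule: active_cases)
    case position
    \<comment> \<open>The gradient has no velocity component, so neither \<open>f2\<close> nor
      \<open>u\<close> enters.\<close>
    then show ?thesis
      using pos by (simp add: grad_Bcomp drift_def stacked_mult_def input_matrix_def inner_prod_def)
  next
    case (velocity j)
    then have "\<gamma> * hfun a b j (y J) > \<epsilon>" using y[OF J] by (simp add: J_def)
    with velocity show ?thesis
      by (auto simp: grad_Bcomp drift_def stacked_mult_def input_matrix_def inner_prod_def u
          hfun_def inner_simps algebra_simps)
  qed
  then show ?thesis unfolding admissible_def by blast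
qed

theorem mainTheorem5:
  fixes f2 :: "(real^'n) \<times> (real^'n) \<Rightarrow> real^'n"
    and G2 :: "(real^'n) \<times> (real^'n) \<Rightarrow> real^'m^'n"
    and a :: "nat \<Rightarrow> real^'n" and b :: "nat \<Rightarrow> real" and r :: nat
    and L :: "nat set" and Is :: "nat \<Rightarrow> nat set"
    and y :: "nat set \<Rightarrow> (real^'n) \<times> (real^'n)"
    and \<gamma> \<epsilon> \<delta> :: real
  assumes f2_lipschitz: "\<exists>K. K-lipschitz_on UNIV f2"
    and G2_lipschitz: "\<exists>K. K-lipschitz_on UNIV G2"
    and a_nonzero: "\<forall>i\<in>{1..r}. norm (a i) \<noteq> 0"
    and b_nonzero: "\<forall>i\<in>{1..r}. b i \<noteq> 0"
    and ab_independent: "\<forall>i\<in>{1..r}. \<forall>j\<in>{1..r}. i \<noteq> j \<longrightarrow>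
          (a i, b i) \<noteq> (a j, b j) \<and> independent {(a i, b i), (a j, b j)}"
    and L_finite: "finite L" and L_nonempty: "L \<noteq> {}"
    and Is_subset: "\<forall>l\<in>L. Is l \<subseteq> {1..r}" and Is_nonempty: "\<forall>l\<in>L. Is l \<noteq> {}"
    and C_nonempty: "desired_set a b L Is \<noteq> {}"
    and proj_compact: "compact (fst ` desired_set a b L Is)"
    and y_in_C: "\<forall>I\<in>S_cap a b r L Is. y I \<in> desired_set a b L Is"
    and y_positive: "\<forall>I\<in>S_cap a b r L Is. \<forall>i\<in>I. hfun a b i (y I) > 0"
    and delta_def: "\<delta> = Min {hfun a b i (y I) | I i. I \<in> S_cap a b r L Is \<and> i \<in> I}"
    and gamma_pos: "\<gamma> > 0" and eps_pos: "\<epsilon> > 0"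
    and gamma_delta: "\<gamma> * \<delta> > \<epsilon>"
    and G2_right_invertible:
      "\<forall>x\<in>frontier (safe_set a b r L Is \<gamma> \<epsilon>). right_invertible (G2 x)"
  shows "\<exists>U :: (real^'m) set. compact U \<and> U \<subset> UNIV \<and>
           general_safety_condition f2 G2 a b r L Is \<gamma> \<epsilon> U"
proof -
  let ?K = "frontier (safe_set a b r L Is \<gamma> \<epsilon>)"
  let ?W = "\<lambda>u. {x. admissible f2 G2 a b r L Is \<gamma> \<epsilon> u x}"
  have fin: "\<forall>l\<in>L. finite (Is l) \<and> Is l \<noteq> {}"
    using Is_subset Is_nonempty finite_subset by blast
  have cont: "continuous_on UNIV f2" "continuous_on UNIV G2"
    using f2_lipschitz G2_lipschitz lipschitz_on_continuous_on by blast+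
  have compact: "compact ?K"
    using compact_safe_set[OF L_finite L_nonempty Is_subset Is_nonempty
        compact_imp_bounded[OF proj_compact] gamma_pos eps_pos]
    by (rule compact_frontier)
  let ?D = "{hfun a b i (y I) | I i. I \<in> S_cap a b r L Is \<and> i \<in> I}"
  \<comment> \<open>Finiteness makes \<open>Min\<close> a true lower bound.\<close>
  have "?D \<subseteq> (\<lambda>(I, i). hfun a b i (y I)) ` (Pow {1..r} \<times> {1..r})"
    by (force simp: S_cap_def)
  then have "finite ?D"
    by (rule finite_subset) simp
  then have "\<delta> \<le> hfun a b i (y I)" if "I \<in> S_cap a b r L Is" "i \<in> I" for I i
    unfolding delta_def using that by (intro Min_le) auto
  then have y: "\<gamma> * hfun a b i (y I) > \<epsilon>" if "I \<in> S_cap a b r L Is" "i \<in> I" for I i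
    using that gamma_delta gamma_pos by (meson mult_left_mono less_imp_le less_le_trans)
  have "?K \<subseteq> (\<Union>u\<in>UNIV. ?W u)"
  proof
    fix x assume x: "x \<in> ?K"
    have "Bfun a b r L Is \<gamma> \<epsilon> x = 0"
      by (rule Bfun_frontier_safe_set[OF L_finite L_nonempty fin x])
    moreover have "right_invertible (G2 x)"
      using G2_right_invertible x by blast
    ultimately have "\<exists>u. admissible f2 G2 a b r L Is \<gamma> \<epsilon> u x"
      by (intro admissible_input_exists[where y = y] L_finite L_nonempty Is_subset eps_pos y)
    then show "x \<in> (\<Union>u\<in>UNIV. ?W u)" by blast
  qed
  with compact obtain U where U: "finite U" "?K \<subseteq> (\<Union>u\<in>U. ?W u)"
    using open_admissible[OF cont L_finite L_nonempty fin]
    by (elim compactE_image) auto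
  \<comment> \<open>The input space has positive dimension because the index type is inhabited, so
    it is unbounded, unlike a finite set.\<close>
  have "U \<noteq> UNIV"
    using U(1) not_bounded_UNIV finite_imp_bounded by metis
  moreover have "general_safety_condition f2 G2 a b r L Is \<gamma> \<epsilon> U"
    using U(2) unfolding general_safety_condition_def admissible_def by blast
  ultimately show ?thesis
    using U(1) finite_imp_compact by blast
qed

end
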